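(* Let $\nu>0$, $\Delta t>0$, and let $\mathsf{F}=(f_{ij})\in\mathbb{R}^{N\times N}$ be the matrix of a family of stencils satisfying the moment conditions of order $n\in\{1,2\}$ given in the context (no sign condition assumed). Put $\mathsf{C}:=\mathsf{I}+\nu\Delta t\,\mathsf{F}^\top$, where $\mathsf{I}$ is the $N\times N$ identity matrix. Then $$\Vert\mathsf{C}\Vert_1=1$$ if and only if the stencils are positive, i.e. $f_{ii}\le0$ for all $i$ and $f_{ij}\ge0$ for all $i\neq j$, and for all $i=1,\dots,N$ $$\nu\Delta t\le -f_{ii}^{-1}$$ (where this last condition is regarded as void for those $i$ with $f_{ii}=0$). For larger $\Delta t$ (i.e. if $\nu\Delta t>-f_{ii}^{-1}$ for some $i$ with $f_{ii}<0$) or for non-positive stencils one always has $\Vert\mathsf{C}\Vert_1>1$.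
   Context: $\Vert\cdot\Vert_1$ is the matrix norm induced by the $l^1$ vector norm (maximum absolute column sum). The matrix $\mathsf{C}$ is the iteration matrix of the forward Euler method $\mathsf{\Gamma}^{m+1}=\mathsf{C}\mathsf{\Gamma}^m$ with step-width $\Delta t$ for the heat equation $\partial_t\omega=\nu\Delta\omega$, discretised in space by $\Delta_h\omega=\sum_{i,j}f_{ij}\Gamma_i\delta(\mathbf{x}-\mathbf{x}_j)$ for a particle cloud $\omega=\sum_{i=1}^N\Gamma_i\delta(\mathbf{x}-\mathbf{x}_i)$ with $\mathbf{x}_i\in\mathbb{R}^2$, $\Gamma_i\in\mathbb{R}$. Moment conditions: let $\mathbf{r}_{ij}:=\mathbf{x}_j-\mathbf{x}_i$ with components $\mathbf{r}_{ij}^x,\mathbf{r}_{ij}^y$, and $\mathbf{r}_{ij}^\alpha=(\mathbf{r}_{ij}^x)^{\alpha_1}(\mathbf{r}_{ij}^y)^{\alpha_2}$. For fixed $h>0$ and $R>r>0$ let $\mathcal{N}_i:=\{j\in\{1,\dots,N\}: rh\le|\mathbf{x}_i-\mathbf{x}_j|\le Rh\}\cup\{i\}$. The real numbers $f_{ij}$ satisfy $f_{ij}=0$ for $j\notin\mathcal{N}_i$ and, for every $i$: $\sum_{j=1}^Nf_{ij}\mathbf{r}_{ij}^x\mathbf{r}_{ij}^x=2$, $\sum_{j=1}^Nf_{ij}\mathbf{r}_{ij}^y\mathbf{r}_{ij}^y=2$, $\sum_{j=1}^Nf_{ij}\mathbf{r}_{ij}^x\mathbf{r}_{ij}^y=0$,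 and $\sum_{j=1}^Nf_{ij}\mathbf{r}_{ij}^\alpha=0$ for all multi-indices with $0\le|\alpha|\le n+1$, $|\alpha|\ne2$; the case $\alpha=(0,0)$ says $f_{ii}=-\sum_{j\ne i}f_{ij}$. For indices $i$ with $\Gamma_i=0$ (empty particles) it is also allowed that $f_{ij}=0$ for all $j$ instead. *)

theory Defs
  imports "HOL-Analysis.Analysis"
begin

text \<open>
  Particles are indexed by a finite type \<open>'p\<close>, so that \<open>N = CARD('p) \<ge> 1\<close>. Their positions are
  \<open>x :: 'p \<Rightarrow> real ^ 2\<close>, and the stencil coefficient \<open>f\<^sub>i\<^sub>j\<close> is the matrix entry \<open>F $ i $ j\<close>.
\<close>

definition rel_pos :: "('p \<Rightarrow> real ^ 2) \<Rightarrow> 'p \<Rightarrow> 'p \<Rightarrow> real ^ 2" where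
  "rel_pos x i j = x j - x i"

text \<open>Since \<open>0 ^ 0 = 1\<close>, the multi-index \<open>(0, 0)\<close> yields \<open>1\<close> also for \<open>v = 0\<close>.\<close>

definition multi_power :: "real ^ 2 \<Rightarrow> nat \<times> nat \<Rightarrow> real" where
  "multi_power v \<alpha> = (v $ 1) ^ fst \<alpha> * (v $ 2) ^ snd \<alpha>"

definition neighbourhood :: "real \<Rightarrow> real \<Rightarrow> real \<Rightarrow> ('p \<Rightarrow> real ^ 2) \<Rightarrow> 'p \<Rightarrow> 'p set" where
  "neighbourhood h r R x i = {j. r * h \<le> norm (x i - x j) \<and> norm (x i - x j) \<le> R * h} \<union> {i}"

definition moment_conditions ::
    "nat \<Rightarrow> ('p::finite \<Rightarrow> real ^ 2) \<Rightarrow> real ^ 'p ^ 'p \<Rightarrow> 'p \<Rightarrow> bool" where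
  "moment_conditions n x F i \<longleftrightarrow>
     (\<Sum>j\<in>UNIV. F $ i $ j * (rel_pos x i j $ 1 * rel_pos x i j $ 1)) = 2 \<and>
     (\<Sum>j\<in>UNIV. F $ i $ j * (rel_pos x i j $ 2 * rel_pos x i j $ 2)) = 2 \<and>
     (\<Sum>j\<in>UNIV. F $ i $ j * (rel_pos x i j $ 1 * rel_pos x i j $ 2)) = 0 \<and>
     (\<forall>\<alpha>. fst \<alpha> + snd \<alpha> \<le> n + 1 \<and> fst \<alpha> + snd \<alpha> \<noteq> 2 \<longrightarrow>
        (\<Sum>j\<in>UNIV. F $ i $ j * multi_power (rel_pos x i j) \<alpha>) = 0)"

text \<open>Only an empty particle (\<open>\<Gamma> $ i = 0\<close>) may carry the zero stencil instead.\<close>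

definition stencil_family ::
    "nat \<Rightarrow> real \<Rightarrow> real \<Rightarrow> real \<Rightarrow> ('p::finite \<Rightarrow> real ^ 2) \<Rightarrow> real ^ 'p \<Rightarrow> real ^ 'p ^ 'p \<Rightarrow> bool" where
  "stencil_family n h r R x \<Gamma> F \<longleftrightarrow>
     (\<forall>i. (\<forall>j. j \<notin> neighbourhood h r R x i \<longrightarrow> F $ i $ j = 0) \<and>
          (moment_conditions n x F i \<or> (\<Gamma> $ i = 0 \<and> (\<forall>j. F $ i $ j = 0))))"

definition positive_stencils :: "real ^ 'p ^ 'p \<Rightarrow> bool" where
  "positive_stencils F \<longleftrightarrow> (\<forall>i. F $ i $ i \<le> 0) \<and> (\<forall>i j. i \<noteq> j \<longrightarrow> F $ i $ j \<ge> 0)"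

definition iteration_matrix :: "real \<Rightarrow> real \<Rightarrow> real ^ 'p ^ 'p \<Rightarrow> real ^ 'p ^ 'p" where
  "iteration_matrix \<nu> \<Delta>t F = mat 1 + (\<nu> * \<Delta>t) *\<^sub>R transpose F"

definition l1_norm :: "real ^ 'p::finite \<Rightarrow> real" where
  "l1_norm v = (\<Sum>i\<in>UNIV. \<bar>v $ i\<bar>)"

definition matrix_norm_1 :: "real ^ 'p ^ 'p::finite \<Rightarrow> real" where
  "matrix_norm_1 A = (SUP v\<in>{v. v \<noteq> 0}. l1_norm (A *v v) / l1_norm v)"

lemma l1_norm_pos: "v \<noteq> 0 \<Longrightarrow> l1_norm v > 0"
proof -
  assume "v \<noteq> 0"
  then obtain i where "v $ i \<noteq> 0" by (auto simp: vec_eq_iff)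
  moreover have "\<bar>v $ i\<bar> \<le> l1_norm v"
    unfolding l1_norm_def by (rule member_le_sum) auto
  ultimately show ?thesis by linarith
qed

text \<open>The induced norm is the maximum absolute column sum.\<close>

lemma matrix_norm_1_eq_Max_column_sum:
  fixes A :: "real ^ 'p ^ 'p::finite"
  shows "matrix_norm_1 A = (MAX j. \<Sum>i\<in>UNIV. \<bar>A $ i $ j\<bar>)"
proof -
  define c where "c j = (\<Sum>i\<in>UNIV. \<bar>A $ i $ j\<bar>)" for j
  define M where "M = (MAX j. c j)"
  have c_le: "c j \<le> M" for j unfolding M_def by (rule Max_ge) auto
  have "M \<in> range c" unfolding M_def by (rule Max_in) auto
  then obtain k where k: "M = c k" by auto
  have upper: "l1_norm (A *v v) / l1_norm v \<le> M" if "v \<noteq> 0" for v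
  proof -
    have "l1_norm (A *v v) \<le> (\<Sum>i\<in>UNIV. \<Sum>j\<in>UNIV. \<bar>A $ i $ j\<bar> * \<bar>v $ j\<bar>)"
      unfolding l1_norm_def matrix_vector_mult_def
      by (auto intro!: sum_mono order_trans[OF sum_abs] simp: abs_mult)
    also have "\<dots> = (\<Sum>j\<in>UNIV. c j * \<bar>v $ j\<bar>)"
      by (subst sum.swap) (simp add: c_def sum_distrib_right)
    also have "\<dots> \<le> (\<Sum>j\<in>UNIV. M * \<bar>v $ j\<bar>)"
      by (intro sum_mono mult_right_mono c_le) auto
    also have "\<dots> = M * l1_norm v" by (simp add: l1_norm_def sum_distrib_left)
    finally show ?thesis using l1_norm_pos[OF that] by (simp add: pos_divide_le_eq)
  qed
  have ax: "axis k (1::real) \<noteq> 0" by (simp add: axis_eq_0_iff)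
  have "l1_norm (axis k (1::real)) = 1"
    by (simp add: l1_norm_def axis_def if_distrib cong: if_cong)
  then have attained: "l1_norm (A *v axis k 1) / l1_norm (axis k (1::real)) = M"
    by (simp add: k c_def l1_norm_def matrix_vector_mult_basis column_def)
  have "matrix_norm_1 A = M"
    unfolding matrix_norm_1_def
  proof (rule cSup_eq_maximum)
    show "M \<in> (\<lambda>v. l1_norm (A *v v) / l1_norm v) ` {v. v \<noteq> 0}"
      using attained ax by (metis (mono_tags, lifting) image_eqI mem_Collect_eq)
  qed (use upper in auto)
  then show ?thesis by (simp add: M_def c_def)
qed

end

theory Submission
  imports Defs
begin

text \<open>
  The moment condition for \<open>\<alpha> = (0, 0)\<close> makes every column of the iteration matrix sum to \<open>1\<close>, so
  its absolute column sums are at least \<open>1\<close>, with equality exactly when no entry is negative.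
\<close>

text \<open>The gap between the two sums is a sum of the nonnegative terms
  \<open>\<bar>f i\<bar> - f i\<close>, so it vanishes only if every term does.\<close>

lemma sum_abs_eq_sum_iff:
  fixes f :: "'a \<Rightarrow> 'b::linordered_idom"
  assumes "finite A"
  shows "(\<Sum>i\<in>A. \<bar>f i\<bar>) = (\<Sum>i\<in>A. f i) \<longleftrightarrow> (\<forall>i\<in>A. 0 \<le> f i)"
proof -
  have "(\<Sum>i\<in>A. \<bar>f i\<bar>) = (\<Sum>i\<in>A. f i) \<longleftrightarrow> (\<Sum>i\<in>A. \<bar>f i\<bar> - f i) = 0"
    by (simp add: sum_subtractf)
  also have "\<dots> \<longleftrightarrow> (\<forall>i\<in>A. \<bar>f i\<bar> - f i = 0)"
    using assms by (intro sum_nonneg_eq_0_iff) auto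
  also have "\<dots> \<longleftrightarrow> (\<forall>i\<in>A. 0 \<le> f i)"
    by (auto simp: abs_if not_less)
  finally show ?thesis .
qed

lemma matrix_norm_1_unit_column_sums:
  fixes A :: "real ^ 'p ^ 'p::finite"
  assumes sums: "\<And>j. (\<Sum>i\<in>UNIV. A $ i $ j) = 1"
  shows "matrix_norm_1 A \<ge> 1"
    and "matrix_norm_1 A = 1 \<longleftrightarrow> (\<forall>i j. A $ i $ j \<ge> 0)"
proof -
  define c where "c j = (\<Sum>i\<in>UNIV. \<bar>A $ i $ j\<bar>)" for j
  have norm_eq: "matrix_norm_1 A = Max (range c)"
    by (simp add: matrix_norm_1_eq_Max_column_sum c_def)
  have c_ge: "1 \<le> c j" for j
    using sum_mono[of UNIV "\<lambda>i. A $ i $ j" "\<lambda>i. \<bar>A $ i $ j\<bar>"] sums[of j] by (simp add: c_def)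
  have c_eq: "c j = 1 \<longleftrightarrow> (\<forall>i. A $ i $ j \<ge> 0)" for j
    using sum_abs_eq_sum_iff[of UNIV "\<lambda>i. A $ i $ j"] sums[of j] by (simp add: c_def)
  have c_le: "c j \<le> matrix_norm_1 A" for j
    by (simp add: norm_eq)
  show ge: "matrix_norm_1 A \<ge> 1"
    using c_ge c_le by (rule order_trans)
  \<comment> \<open>With the lower bound at hand, equality becomes an upper bound on a maximum,
    which can be tested column by column.\<close>
  have "matrix_norm_1 A = 1 \<longleftrightarrow> matrix_norm_1 A \<le> 1"
    using ge by auto
  also have "\<dots> \<longleftrightarrow> (\<forall>j. c j \<le> 1)"
    by (simp add: norm_eq)
  also have "\<dots> \<longleftrightarrow> (\<forall>j. c j = 1)"
    using c_ge by (auto intro: antisym)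
  finally show "matrix_norm_1 A = 1 \<longleftrightarrow> (\<forall>i j. A $ i $ j \<ge> 0)"
    using c_eq by auto
qed

text \<open>This is the moment condition for (0, 0); the zero stencil of an empty particle satisfies
  it trivially.\<close>

lemma stencil_family_row_sum:
  assumes "stencil_family n h r R x \<Gamma> F"
  shows "(\<Sum>j\<in>UNIV. F $ i $ j) = 0"
proof -
  consider "moment_conditions n x F i" | "\<forall>j. F $ i $ j = 0"
    using assms unfolding stencil_family_def by blast
  then show ?thesis
  proof cases
    case 1
    then have "(\<Sum>j\<in>UNIV. F $ i $ j * multi_power (rel_pos x i j) (0, 0)) = 0"
      by (simp add: moment_conditions_def)
    then show ?thesis by (simp add: multi_power_def)
  qed simp
qed

lemma iteration_matrix_nth:
  "iteration_matrix \<nu> \<Delta>t F $ i $ j = (if i = j then 1 else 0) + \<nu> * \<Delta>t * F $ j $ i"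
  by (simp add: iteration_matrix_def mat_def transpose_def)

text \<open>Transposition turns the vanishing row sums of \<open>F\<close> into column sums, so only
  the identity contributes. Unit column sums mean that an Euler step conserves the total
  circulation.\<close>

lemma iteration_matrix_column_sum:
  fixes F :: "real ^ 'p ^ 'p::finite"
  assumes "(\<Sum>i\<in>UNIV. F $ j $ i) = 0"
  shows "(\<Sum>i\<in>UNIV. iteration_matrix \<nu> \<Delta>t F $ i $ j) = 1"
  using assms by (simp add: iteration_matrix_nth sum.distrib flip: sum_distrib_left)

text \<open>The diagonal entry is minus the sum of the other entries of its row.\<close>

lemma zero_row_sum_diagonal_nonpos:
  fixes F :: "real ^ 'p ^ 'p::finite"
  assumes "(\<Sum>j\<in>UNIV. F $ i $ j) = 0" and "\<And>j. i \<noteq> j \<Longrightarrow> F $ i $ j \<ge> 0"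
  shows "F $ i $ i \<le> 0"
proof -
  have "0 \<le> (\<Sum>j\<in>UNIV - {i}. F $ i $ j)"
    using assms(2) by (intro sum_nonneg) auto
  then show ?thesis
    using assms(1) by (simp add: sum.remove[of UNIV i])
qed

text \<open>Off-diagonal entries of the iteration matrix carry the signs of the stencil
  coefficients, while the diagonal entries \<open>1 + \<nu> * \<Delta>t * F $ i $ i\<close> give the
  step-width bound.\<close>

lemma iteration_matrix_nonneg_iff:
  fixes F :: "real ^ 'p ^ 'p::finite"
  assumes "\<nu> > 0" and "\<Delta>t > 0" and row_sum: "\<And>i. (\<Sum>j\<in>UNIV. F $ i $ j) = 0"
  shows "(\<forall>i j. iteration_matrix \<nu> \<Delta>t F $ i $ j \<ge> 0) \<longleftrightarrow>
    positive_stencils F \<and> (\<forall>i. F $ i $ i \<noteq> 0 \<longrightarrow> \<nu> * \<Delta>t \<le> - inverse (F $ i $ i))"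
proof -
  define a where "a = \<nu> * \<Delta>t"
  have a: "a > 0" using assms by (simp add: a_def)
  have "(\<forall>i j. iteration_matrix \<nu> \<Delta>t F $ i $ j \<ge> 0) \<longleftrightarrow>
      (\<forall>i. 1 + a * F $ i $ i \<ge> 0) \<and> (\<forall>i j. i \<noteq> j \<longrightarrow> F $ i $ j \<ge> 0)"
    \<comment> \<open>The transposition swaps \<open>i\<close> and \<open>j\<close>, which is
      harmless as all pairs are quantified over.\<close>
    using a by (auto simp: iteration_matrix_nth zero_le_mult_iff simp flip: a_def)
  also have "\<dots> \<longleftrightarrow> (\<forall>i. 1 + a * F $ i $ i \<ge> 0) \<and> positive_stencils F"
  proof -
    \<comment> \<open>Nonnegativity of \<open>1 + a * F $ i $ i\<close> says nothing about the sign
      of \<open>F $ i $ i\<close>; the zero row sum supplies it.\<close>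
    have "F $ i $ i \<le> 0" if "\<forall>i j. i \<noteq> j \<longrightarrow> F $ i $ j \<ge> 0" for i
      using row_sum that by (intro zero_row_sum_diagonal_nonpos) auto
    then show ?thesis by (auto simp: positive_stencils_def)
  qed
  also have "\<dots> \<longleftrightarrow> positive_stencils F \<and> (\<forall>i. F $ i $ i \<noteq> 0 \<longrightarrow> a \<le> - inverse (F $ i $ i))"
  proof -
    \<comment> \<open>For \<open>d < 0\<close> this is division by \<open>d\<close>. For
      \<open>d = 0\<close> both sides hold; the guard matters, since \<open>inverse 0 = 0\<close>
      would turn the bound into \<open>a \<le> 0\<close>.\<close>
    have "1 + a * d \<ge> 0 \<longleftrightarrow> (d \<noteq> 0 \<longrightarrow> a \<le> - inverse d)" if "d \<le> 0" for d :: real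
      using that by (cases "d = 0") (auto simp: field_simps)
    then show ?thesis by (auto simp: positive_stencils_def)
  qed
  finally show ?thesis by (simp add: a_def)
qed

theorem theorem2:
  fixes x :: "'p::finite \<Rightarrow> real ^ 2"
    and \<Gamma> :: "real ^ 'p"
    and F :: "real ^ 'p ^ 'p"
    and h r R \<nu> \<Delta>t :: real
    and n :: nat
  assumes "h > 0" and "r > 0" and "R > r"
    and "\<nu> > 0" and "\<Delta>t > 0"
    and "n \<in> {1, 2}"
    and "stencil_family n h r R x \<Gamma> F"
  shows "(matrix_norm_1 (iteration_matrix \<nu> \<Delta>t F) = 1 \<longleftrightarrow>
            positive_stencils F \<and> (\<forall>i. F $ i $ i \<noteq> 0 \<longrightarrow> \<nu> * \<Delta>t \<le> - inverse (F $ i $ i)))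
       \<and> ((\<exists>i. F $ i $ i < 0 \<and> \<nu> * \<Delta>t > - inverse (F $ i $ i)) \<or> \<not> positive_stencils F \<longrightarrow>
            matrix_norm_1 (iteration_matrix \<nu> \<Delta>t F) > 1)"
proof -
  let ?C = "iteration_matrix \<nu> \<Delta>t F"
  have row_sum: "(\<Sum>j\<in>UNIV. F $ i $ j) = 0" for i
    using assms(7) by (rule stencil_family_row_sum)
  note column_sum = iteration_matrix_column_sum[OF row_sum]
  have norm_ge: "matrix_norm_1 ?C \<ge> 1"
    using column_sum by (rule matrix_norm_1_unit_column_sums)
  have norm_eq: "matrix_norm_1 ?C = 1 \<longleftrightarrow>
      positive_stencils F \<and> (\<forall>i. F $ i $ i \<noteq> 0 \<longrightarrow> \<nu> * \<Delta>t \<le> - inverse (F $ i $ i))"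
    using matrix_norm_1_unit_column_sums(2)[OF column_sum]
      iteration_matrix_nonneg_iff[OF assms(4,5) row_sum] by (rule trans)
  have "matrix_norm_1 ?C > 1"
    if "(\<exists>i. F $ i $ i < 0 \<and> \<nu> * \<Delta>t > - inverse (F $ i $ i)) \<or> \<not> positive_stencils F"
  proof -
    \<comment> \<open>Either alternative refutes the right-hand side of \<open>norm_eq\<close>: a
      negative diagonal entry is nonzero, so its step-width bound is in force and violated.\<close>
    have "matrix_norm_1 ?C \<noteq> 1"
      using norm_eq that by (metis leD less_irrefl)
    with norm_ge show ?thesis by simp
  qed
  with norm_eq show ?thesis by blast
qed

end
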